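(* Consider two vehicles, ownship ($o$) and intruder ($i$), each performing non-deterministic turn-to-bearing motion, and let $C=E^o\cap E^i$. For every $p\in C$, the predicate $$W(p)=\big(t^o_e(p)\le t^i_e(p)\le t^o_l(p)\big)\lor\big(t^i_e(p)\le t^o_e(p)\le t^i_l(p)\big)$$ holds if and only if there exist an ownship trajectory $J^o$, an intruder trajectory $J^i$ and a time $t$ with $J^o(t)=J^i(t)=p$ (i.e. a collision at $p$ is possible).
   Context: Non-deterministic turn-to-bearing motion of a vehicle is described by a tuple $(x_0,y_0,\theta_0,r_\alpha,r_\beta,\theta_\alpha,\theta_\beta,s_\alpha,s_\beta)$ with either $0<r_\alpha\le r_\beta$, $0<\theta_\alpha<\theta_\beta<2\pi$ (left turn) or $r_\alpha\le r_\beta<0$, $-2\pi<\theta_\alpha<\theta_\beta<0$ (right turn), and $0<s_\alpha\le s_\beta$. A trajectory is determined by $r\in[r_\alpha,r_\beta]$, $\theta_c\in[\theta_\alpha,\theta_\beta]$ and a continuous speed function $s$ with $s(u)\in[s_\alpha,s_\beta]$ for all $u$; with $d(t)=\int_0^t s(\gamma)\,d\gamma$, it is $J(t)=(J_x(t),J_y(t))$ where for $d(t)\le r\theta_c$: $J_x=r\sin(d(t)/r+\theta_0)-r\sin\theta_0+x_0$, $J_y=-r\cos(d(t)/r+\theta_0)+r\cos\theta_0+y_0$; and for $d(t)>r\theta_c$: $J_x=(d(t)-r\theta_c)\cos(\theta_c+\theta_0)+r\sin(\theta_c+\theta_0)-r\sin\theta_0+x_0$, $J_y=(d(t)-r\theta_c)\sin(\theta_c+\theta_0)-r\cos(\theta_c+\theta_0)+r\cos\theta_0+y_0$.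 The reachable envelope is $E=\{p:\exists$ trajectory $J$ and $u>0$ with $J(u)=p\}$. For $p\in E$, $\mathcal T(p)$ is the set of trajectories $J$ with $J(u)=p$ for some $u>0$, $I(p)=\{t_a: J\in\mathcal T(p),\ J(t_a)=p\}$, $t_e(p)=\inf I(p)$, $t_l(p)=\sup I(p)$. Ownship and intruder each have their own tuple; superscripts $o,i$ indicate the vehicle. *)

theory Defs
  imports "HOL-Analysis.Analysis"
begin

record turn_to_bearing =
  x0 :: real
  y0 :: real
  theta0 :: real
  r_alpha :: real
  r_beta :: real
  theta_alpha :: real
  theta_beta :: real
  s_alpha :: real
  s_beta :: real

text \<open>Left turns have positive, right turns negative radii and turn angles.\<close>

definition turn_to_bearing_motion :: "turn_to_bearing \<Rightarrow> bool" where
  "turn_to_bearing_motion v \<longleftrightarrow>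
     ((0 < r_alpha v \<and> r_alpha v \<le> r_beta v \<and>
       0 < theta_alpha v \<and> theta_alpha v < theta_beta v \<and> theta_beta v < 2 * pi) \<or>
      (r_alpha v \<le> r_beta v \<and> r_beta v < 0 \<and>
       - 2 * pi < theta_alpha v \<and> theta_alpha v < theta_beta v \<and> theta_beta v < 0)) \<and>
     0 < s_alpha v \<and> s_alpha v \<le> s_beta v"

definition travelled :: "(real \<Rightarrow> real) \<Rightarrow> real \<Rightarrow> real" where
  "travelled s t = integral {0..t} s"

definition position :: "turn_to_bearing \<Rightarrow> real \<Rightarrow> real \<Rightarrow> (real \<Rightarrow> real) \<Rightarrow> real \<Rightarrow> real \<times> real" where
  "position v r \<theta>c s t =
     (let d = travelled s t in
      if d \<le> r * \<theta>c then
        (r * sin (d / r + theta0 v) - r * sin (theta0 v) + x0 v,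
         - r * cos (d / r + theta0 v) + r * cos (theta0 v) + y0 v)
      else
        ((d - r * \<theta>c) * cos (\<theta>c + theta0 v)
           + r * sin (\<theta>c + theta0 v) - r * sin (theta0 v) + x0 v,
         (d - r * \<theta>c) * sin (\<theta>c + theta0 v)
           - r * cos (\<theta>c + theta0 v) + r * cos (theta0 v) + y0 v))"

text \<open>Time ranges over the nonnegative reals: speeds are constrained there only, and values of
  a trajectory at negative arguments carry no meaning and are never used below.\<close>

definition trajectories :: "turn_to_bearing \<Rightarrow> (real \<Rightarrow> real \<times> real) set" where
  "trajectories v =
     {position v r \<theta>c s | r \<theta>c s.
        r \<in> {r_alpha v..r_beta v} \<and> \<theta>c \<in> {theta_alpha v..theta_beta v} \<and>
        continuous_on {0..} s \<and> (\<forall>u\<ge>0. s u \<in> {s_alpha v..s_beta v})}"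

definition envelope :: "turn_to_bearing \<Rightarrow> (real \<times> real) set" where
  "envelope v = {p. \<exists>J\<in>trajectories v. \<exists>u>0. J u = p}"

definition trajectories_through :: "turn_to_bearing \<Rightarrow> real \<times> real \<Rightarrow> (real \<Rightarrow> real \<times> real) set" where
  "trajectories_through v p = {J \<in> trajectories v. \<exists>u>0. J u = p}"

definition arrival_times :: "turn_to_bearing \<Rightarrow> real \<times> real \<Rightarrow> real set" where
  "arrival_times v p = {t. t \<ge> 0 \<and> (\<exists>J\<in>trajectories_through v p. J t = p)}"

definition earliest :: "turn_to_bearing \<Rightarrow> real \<times> real \<Rightarrow> real" where
  "earliest v p = Inf (arrival_times v p)"

definition latest :: "turn_to_bearing \<Rightarrow> real \<times> real \<Rightarrow> real" where
  "latest v p = Sup (arrival_times v p)"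

definition W :: "turn_to_bearing \<Rightarrow> turn_to_bearing \<Rightarrow> real \<times> real \<Rightarrow> bool" where
  "W ownship intruder p \<longleftrightarrow>
     (earliest ownship p \<le> earliest intruder p \<and> earliest intruder p \<le> latest ownship p) \<or>
     (earliest intruder p \<le> earliest ownship p \<and> earliest ownship p \<le> latest intruder p)"

end

theory Submission
  imports Defs
begin

text \<open>For a fixed vehicle and a reachable point \<open>p\<close>, the set of arrival times is a compact interval;
  for two such intervals, \<open>W\<close> says precisely that they intersect.

  After mirroring right turns and moving to the frame of the initial pose, \<open>p = (x, y)\<close> is reached
  by turning through an angle \<open>\<psi>\<close> on a circle of radius \<open>r\<close> and then going straight for a length
  \<open>l \<ge> 0\<close>; arrival on the arc itself is the case \<open>l = 0\<close>, where the bearing \<open>\<theta>\<^sub>c\<close> need only exceed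
  \<open>\<psi>\<close>. In terms of \<open>k = cot (\<psi>/2)\<close> these equations have the polynomial solution
  \<open>l = y k - x\<close>, \<open>r = y/2 + x k - y k\<^sup>2/2\<close> with \<open>dr/dk = -l\<close>. Hence \<open>r\<close> is monotone where \<open>l \<ge> 0\<close>,
  and the admissible \<open>k\<close> form a compact interval. Its image under the path length \<open>r \<psi> + l\<close> is a
  compact interval of distances \<open>[a, b]\<close> with \<open>a > 0\<close>, and constant speeds already realise all arrival times
  in \<open>[a / s\<^sub>\<beta>, b / s\<^sub>\<alpha>]\<close>.\<close>

text \<open>This is \<open>2 arccot k\<close>, ranging over \<open>(0, 2\<pi>)\<close>.\<close>

definition turn_angle :: "real \<Rightarrow> real" where
  "turn_angle k = pi - 2 * arctan k"

definition turn_radius :: "real \<Rightarrow> real \<Rightarrow> real \<Rightarrow> real" where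
  "turn_radius x y k = y / 2 + x * k - y * k\<^sup>2 / 2"

definition straight_length :: "real \<Rightarrow> real \<Rightarrow> real \<Rightarrow> real" where
  "straight_length x y k = y * k - x"

definition path_length :: "real \<Rightarrow> real \<Rightarrow> real \<Rightarrow> real" where
  "path_length x y k = turn_radius x y k * turn_angle k + straight_length x y k"

text \<open>Position after distance \<open>d\<close> in the frame of the initial pose: start at the
  origin, heading along the first axis. Only the distance enters, so speed can be treated
  separately.\<close>

definition left_path :: "real \<Rightarrow> real \<Rightarrow> real \<Rightarrow> real \<times> real" where
  "left_path r \<phi> d =
     (if d \<le> r * \<phi> then (r * sin (d / r), r * (1 - cos (d / r)))
      else (r * sin \<phi> + (d - r * \<phi>) * cos \<phi>, r * (1 - cos \<phi>) + (d - r * \<phi>) * sin \<phi>))"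

definition left_distances ::
  "real \<Rightarrow> real \<Rightarrow> real \<Rightarrow> real \<Rightarrow> real \<times> real \<Rightarrow> real set" where
  "left_distances ra rb pa pb q =
     {d. 0 < d \<and> (\<exists>r\<in>{ra..rb}. \<exists>\<phi>\<in>{pa..pb}. left_path r \<phi> d = q)}"

text \<open>The last disjunct drops the lower bound \<open>pa\<close> for arrivals on the arc, which
  stay possible when the final bearing lies further along. The upper bound \<open>pb\<close> applies
  in both cases.\<close>

definition turn_cotangents ::
  "real \<Rightarrow> real \<Rightarrow> real \<Rightarrow> real \<Rightarrow> real \<Rightarrow> real \<Rightarrow> real set" where
  "turn_cotangents ra rb pa pb x y =
     {k. turn_angle k \<le> pb \<and> 0 \<le> straight_length x y k \<and>
         ra \<le> turn_radius x y k \<and> turn_radius x y k \<le> rb \<and>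
         (pa \<le> turn_angle k \<or> straight_length x y k = 0)}"

section \<open>Half-angle coordinates for a turn followed by a straight segment\<close>

lemma turn_angle_bounds: "0 < turn_angle k" "turn_angle k < 2 * pi"
  unfolding turn_angle_def using arctan_bounded[of k] by auto

lemma turn_angle_antimono: "turn_angle k \<le> turn_angle l \<longleftrightarrow> l \<le> k"
  by (simp add: turn_angle_def arctan_le_iff)

lemma turn_angle_surj:
  assumes "0 < \<phi>" "\<phi> < 2 * pi"
  obtains k where "turn_angle k = \<phi>"
proof
  have "arctan (tan ((pi - \<phi>) / 2)) = (pi - \<phi>) / 2"
    by (rule arctan_tan) (use assms in auto)
  then show "turn_angle (tan ((pi - \<phi>) / 2)) = \<phi>"
    by (simp add: turn_angle_def)
qed

lemma sin_turn_angle: "sin (turn_angle k) = 2 * k / (1 + k\<^sup>2)"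
  and cos_turn_angle: "cos (turn_angle k) = (k\<^sup>2 - 1) / (1 + k\<^sup>2)"
proof -
  have pos: "1 + k\<^sup>2 > 0" by (simp add: add_pos_nonneg)
  have s: "(sqrt (1 + k\<^sup>2))\<^sup>2 = 1 + k\<^sup>2" using pos by simp
  have "sin (turn_angle k) = sin (2 * arctan k)" by (simp add: turn_angle_def)
  also have "\<dots> = 2 * k / (sqrt (1 + k\<^sup>2))\<^sup>2"
    by (simp add: sin_double sin_arctan cos_arctan power2_eq_square)
  finally show "sin (turn_angle k) = 2 * k / (1 + k\<^sup>2)" using s by simp
  have "cos (turn_angle k) = - cos (2 * arctan k)" by (simp add: turn_angle_def)
  also have "\<dots> = (k\<^sup>2 - 1) / (sqrt (1 + k\<^sup>2))\<^sup>2"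
    unfolding cos_double by (simp add: sin_arctan cos_arctan power_divide diff_divide_distrib)
  finally show "cos (turn_angle k) = (k\<^sup>2 - 1) / (1 + k\<^sup>2)" using s by simp
qed

text \<open>For fixed \<open>k\<close> this is a linear system in \<open>r\<close> and
  \<open>l\<close> whose determinant \<open>1 - cos (turn_angle k) = 2 / (1 + k\<^sup>2)\<close> is
  nonzero, so its solution is unique.\<close>

lemma turn_then_straight_iff:
  "(r * sin (turn_angle k) + l * cos (turn_angle k),
    r * (1 - cos (turn_angle k)) + l * sin (turn_angle k)) = (x, y)
   \<longleftrightarrow> r = turn_radius x y k \<and> l = straight_length x y k"
proof -
  have pos: "1 + k\<^sup>2 \<noteq> 0" by (metis add_pos_nonneg less_irrefl zero_le_power2 zero_less_one)
  have c: "1 - (k\<^sup>2 - 1) / (1 + k\<^sup>2) = 2 / (1 + k\<^sup>2)" using pos by (simp add: field_simps)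
  have "r * sin (turn_angle k) + l * cos (turn_angle k) = (2 * r * k + l * (k\<^sup>2 - 1)) / (1 + k\<^sup>2)"
    by (simp add: sin_turn_angle cos_turn_angle add_divide_distrib)
  moreover have "r * (1 - cos (turn_angle k)) + l * sin (turn_angle k) = (2 * r + 2 * k * l) / (1 + k\<^sup>2)"
    unfolding sin_turn_angle cos_turn_angle c by (simp add: add_divide_distrib mult_ac)
  ultimately have "(r * sin (turn_angle k) + l * cos (turn_angle k),
      r * (1 - cos (turn_angle k)) + l * sin (turn_angle k)) = (x, y) \<longleftrightarrow>
     2 * r * k + l * (k\<^sup>2 - 1) = x * (1 + k\<^sup>2) \<and> 2 * r + 2 * k * l = y * (1 + k\<^sup>2)"
    using pos by (simp add: divide_eq_eq)
  also have "\<dots> \<longleftrightarrow> r = turn_radius x y k \<and> l = straight_length x y k"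
  proof
    assume a: "2 * r * k + l * (k\<^sup>2 - 1) = x * (1 + k\<^sup>2) \<and> 2 * r + 2 * k * l = y * (1 + k\<^sup>2)"
    \<comment> \<open>Subtracting the first equation from \<open>k\<close> times the second
      eliminates \<open>r\<close>.\<close>
    have "2 * (r * k) + 2 * (l * k\<^sup>2) = k * (2 * r + 2 * k * l)"
      by (simp add: algebra_simps power2_eq_square)
    also have "\<dots> = k * (y * (1 + k\<^sup>2))" using a by simp
    finally have "l * (1 + k\<^sup>2) = (y * k - x) * (1 + k\<^sup>2)"
      using a[THEN conjunct1] by (simp add: algebra_simps)
    then have l: "l = y * k - x" using pos by simp
    have "r = y / 2 + x * k - y * k\<^sup>2 / 2"
      using a unfolding l by (simp add: algebra_simps power2_eq_square)
    with l show "r = turn_radius x y k \<and> l = straight_length x y k"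
      by (simp add: turn_radius_def straight_length_def)
  next
    assume rl: "r = turn_radius x y k \<and> l = straight_length x y k"
    show "2 * r * k + l * (k\<^sup>2 - 1) = x * (1 + k\<^sup>2) \<and> 2 * r + 2 * k * l = y * (1 + k\<^sup>2)"
      unfolding rl[THEN conjunct1] rl[THEN conjunct2]
      by (simp add: turn_radius_def straight_length_def algebra_simps power2_eq_square)
  qed
  finally show ?thesis .
qed

text \<open>An arc arrival corresponds to turn angle \<open>d / r\<close> and length 0, a straight
  arrival to turn angle \<open>\<phi>\<close> and length \<open>d - r * \<phi>\<close>.\<close>

lemma left_distances_eq_image:
  assumes "0 < ra" "0 < pa" "pa \<le> pb" "pb < 2 * pi"
  shows "left_distances ra rb pa pb (x, y) = path_length x y ` turn_cotangents ra rb pa pb x y"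
proof (intro equalityI subsetI)
  fix d assume "d \<in> left_distances ra rb pa pb (x, y)"
  then obtain r \<phi> where d: "0 < d" and r: "ra \<le> r" "r \<le> rb" and \<phi>: "pa \<le> \<phi>" "\<phi> \<le> pb"
    and eq: "left_path r \<phi> d = (x, y)"
    by (auto simp: left_distances_def)
  have "0 < r" using r assms by simp
  show "d \<in> path_length x y ` turn_cotangents ra rb pa pb x y"
  proof (cases "d \<le> r * \<phi>")
    case True
    have ang: "0 < d / r" "d / r \<le> \<phi>" using d True \<open>0 < r\<close> by (auto simp: field_simps)
    then obtain k where k: "turn_angle k = d / r"
      using turn_angle_surj[of "d / r"] \<phi> assms by force
    have "r = turn_radius x y k \<and> 0 = straight_length x y k"
      using eq True turn_then_straight_iff[of r k 0 x y] by (simp add: left_path_def k)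
    then have "k \<in> turn_cotangents ra rb pa pb x y" "path_length x y k = d"
      using r ang k \<phi> \<open>0 < r\<close> by (auto simp: turn_cotangents_def path_length_def)
    then show ?thesis by blast
  next
    case False
    obtain k where k: "turn_angle k = \<phi>"
      using turn_angle_surj[of \<phi>] \<phi> assms by force
    have "(r * sin (turn_angle k) + (d - r * \<phi>) * cos (turn_angle k),
        r * (1 - cos (turn_angle k)) + (d - r * \<phi>) * sin (turn_angle k)) = (x, y)"
      using eq False by (simp add: left_path_def k)
    then have "r = turn_radius x y k \<and> d - r * \<phi> = straight_length x y k"
      unfolding turn_then_straight_iff .
    then have "k \<in> turn_cotangents ra rb pa pb x y" "path_length x y k = d"
      using r k \<phi> False by (auto simp: turn_cotangents_def path_length_def)
    then show ?thesis by blast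
  qed
next
  fix d assume "d \<in> path_length x y ` turn_cotangents ra rb pa pb x y"
  then obtain k where k: "k \<in> turn_cotangents ra rb pa pb x y" and d: "d = path_length x y k"
    by blast
  define r l \<psi> where "r = turn_radius x y k" and "l = straight_length x y k"
    and "\<psi> = turn_angle k"
  have r: "ra \<le> r" "r \<le> rb" and l: "0 \<le> l" and \<psi>: "\<psi> \<le> pb" "pa \<le> \<psi> \<or> l = 0"
    using k by (auto simp: turn_cotangents_def r_def l_def \<psi>_def)
  have d: "d = r * \<psi> + l" using d by (simp add: path_length_def r_def l_def \<psi>_def)
  have "0 < r" using r assms by simp
  have "0 < \<psi>" by (simp add: \<psi>_def turn_angle_bounds)
  have "0 < d" using d l \<open>0 < r\<close> \<open>0 < \<psi>\<close> by (simp add: add_pos_nonneg)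
  have xy: "(r * sin \<psi> + l * cos \<psi>, r * (1 - cos \<psi>) + l * sin \<psi>) = (x, y)"
    unfolding \<psi>_def turn_then_straight_iff by (simp add: r_def l_def)
  have "\<exists>\<phi>\<in>{pa..pb}. left_path r \<phi> d = (x, y)"
  proof (cases "l = 0")
    case True
    \<comment> \<open>The bearing \<open>max \<psi> pa\<close> is admissible and not below
      \<open>\<psi>\<close>, so the distance \<open>r * \<psi>\<close> still falls in the arc
      branch.\<close>
    have "r * \<psi> \<le> r * max \<psi> pa" using \<open>0 < r\<close> by simp
    then have "left_path r (max \<psi> pa) d = (x, y)"
      using d True xy \<open>0 < r\<close> by (simp add: left_path_def)
    then show ?thesis using \<psi> assms by (intro bexI[of _ "max \<psi> pa"]) auto
  next
    case False
    then have "left_path r \<psi> d = (x, y)" using l d xy by (simp add: left_path_def)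
    then show ?thesis using \<psi> False by auto
  qed
  then show "d \<in> left_distances ra rb pa pb (x, y)"
    using r \<open>0 < d\<close> by (auto simp: left_distances_def)
qed

section \<open>The admissible cotangents form a compact interval\<close>

text \<open>The trapezoidal rule is exact for the affine derivative \<open>-l\<close> of the radius,
  so the difference of radii is an explicit product of nonnegative factors.\<close>

lemma turn_radius_mono:
  assumes "k \<le> l" "0 \<le> straight_length x y k" "0 \<le> straight_length x y l"
  shows "turn_radius x y l \<le> turn_radius x y k"
proof -
  have "0 \<le> (l - k) * (straight_length x y k + straight_length x y l)"
    using assms by simp
  also have "\<dots> = 2 * (turn_radius x y k - turn_radius x y l)"
    by (simp add: turn_radius_def straight_length_def algebra_simps power2_eq_square)
  finally show ?thesis by simp
qed

text \<open>Zero length means \<open>x = y * k\<close>, which turns the radius into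
  \<open>y * (1 + k\<^sup>2) / 2\<close>.\<close>

lemma pos_if_turn_radius_pos:
  assumes "straight_length x y k = 0" "0 < turn_radius x y k"
  shows "0 < y"
proof -
  have x: "x = y * k" using assms by (simp add: straight_length_def)
  have "turn_radius x y k = y * (1 + k\<^sup>2) / 2"
    unfolding x turn_radius_def by (simp add: algebra_simps power2_eq_square)
  with assms(2) have "0 < y * (1 + k\<^sup>2)" by simp
  then show ?thesis by (simp add: zero_less_mult_iff) (smt (verit) zero_le_power2)
qed

text \<open>The length is affine in \<open>k\<close>, hence nonnegative between two points where it
  is; the radius and the angle are then trapped between their values at the ends. Only the
  disjunction needs care: the bound \<open>pa\<close> has to come from the larger end
  \<open>k2\<close>, where the angle is smaller.\<close>

lemma is_interval_turn_cotangents: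
  assumes "0 < ra"
  shows "is_interval (turn_cotangents ra rb pa pb x y)"
  unfolding is_interval_1
proof (intro ballI allI impI)
  fix k1 k2 k
  assume k1: "k1 \<in> turn_cotangents ra rb pa pb x y" and k2: "k2 \<in> turn_cotangents ra rb pa pb x y"
    and k: "k1 \<le> k \<and> k \<le> k2"
  show "k \<in> turn_cotangents ra rb pa pb x y"
  proof (cases "k = k1 \<or> k = k2")
    case True
    then show ?thesis using k1 k2 by blast
  next
    case False
    with k have k: "k1 < k" "k < k2" by auto
    have angle: "turn_angle k \<le> turn_angle k1" "turn_angle k2 \<le> turn_angle k"
      using k by (auto simp: turn_angle_antimono)
    have 1: "0 \<le> straight_length x y k1" "0 \<le> straight_length x y k2"
      using k1 k2 by (auto simp: turn_cotangents_def)
    have len: "0 \<le> straight_length x y k"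
    proof (cases "0 \<le> y")
      case True
      then have "y * k1 \<le> y * k" using k by (simp add: mult_left_mono)
      with 1 show ?thesis by (simp add: straight_length_def)
    next
      case False
      then have "y * k2 \<le> y * k" using k by (simp add: mult_left_mono_neg)
      with 1 show ?thesis by (simp add: straight_length_def)
    qed
    have "turn_radius x y k \<le> turn_radius x y k1" "turn_radius x y k2 \<le> turn_radius x y k"
      using turn_radius_mono k 1 len by auto
    \<comment> \<open>An arc arrival with \<open>\<psi> < pa\<close> forces \<open>y > 0\<close>; then \<open>l\<close> is negative at every smaller \<open>k\<close>,
      so this arrival is the only one.\<close>
    moreover have "pa \<le> turn_angle k2"
    proof (rule ccontr)
      assume "\<not> ?thesis"
      then have z: "straight_length x y k2 = 0" using k2 by (auto simp: turn_cotangents_def)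
      then have "0 < y"
        using k2 assms pos_if_turn_radius_pos[of x y k2] by (auto simp: turn_cotangents_def)
      then have "y * k1 < y * k2" using k by simp
      with z 1 show False by (simp add: straight_length_def)
    qed
    ultimately show ?thesis
      using k1 k2 angle len by (auto simp: turn_cotangents_def)
  qed
qed

text \<open>The angle bounds \<open>pb\<close> and \<open>pa\<close> bound \<open>k\<close> from
  below and above. Arc arrivals may violate the latter, but for them
  \<open>k = x / y\<close>.\<close>

lemma compact_turn_cotangents:
  assumes "0 < ra" "0 < pa" "pa \<le> pb" "pb < 2 * pi"
  shows "compact (turn_cotangents ra rb pa pb x y)"
proof -
  obtain ka where ka: "turn_angle ka = pa" using turn_angle_surj[of pa] assms by force
  obtain kb where kb: "turn_angle kb = pb" using turn_angle_surj[of pb] assms by force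
  have "turn_cotangents ra rb pa pb x y \<subseteq> {kb..max ka (x / y)}"
  proof
    fix k assume k: "k \<in> turn_cotangents ra rb pa pb x y"
    then have "turn_angle k \<le> turn_angle kb" by (auto simp: kb turn_cotangents_def)
    moreover have "k \<le> ka \<or> k = x / y"
    proof (cases "pa \<le> turn_angle k")
      case True
      then show ?thesis by (simp flip: ka add: turn_angle_antimono)
    next
      case False
      then have z: "straight_length x y k = 0" using k by (auto simp: turn_cotangents_def)
      then have "0 < y"
        using k assms pos_if_turn_radius_pos[of x y k] by (auto simp: turn_cotangents_def)
      with z show ?thesis by (simp add: straight_length_def field_simps)
    qed
    ultimately show "k \<in> {kb..max ka (x / y)}" by (auto simp: turn_angle_antimono)
  qed
  then have "bounded (turn_cotangents ra rb pa pb x y)"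
    using bounded_closed_interval bounded_subset by blast
  moreover have "closed (turn_cotangents ra rb pa pb x y)"
    unfolding turn_cotangents_def turn_angle_def straight_length_def turn_radius_def
    by (intro closed_Collect_conj closed_Collect_disj closed_Collect_le closed_Collect_eq
        continuous_intros) auto
  ultimately show ?thesis by (simp add: compact_eq_bounded_closed)
qed

lemma left_distances_interval:
  assumes "0 < ra" "0 < pa" "pa \<le> pb" "pb < 2 * pi"
    and "left_distances ra rb pa pb q \<noteq> {}"
  obtains a b where "0 < a" "a \<le> b" "left_distances ra rb pa pb q = {a..b}"
proof -
  obtain x y where q: "q = (x, y)" by (cases q)
  let ?M = "turn_cotangents ra rb pa pb x y" and ?D = "left_distances ra rb pa pb q"
  have D: "?D = path_length x y ` ?M"
    unfolding q using assms by (intro left_distances_eq_image)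
  have "continuous_on ?M (path_length x y)"
    unfolding path_length_def turn_angle_def straight_length_def turn_radius_def
    by (intro continuous_intros) auto
  moreover have "connected ?M" "compact ?M"
    using is_interval_turn_cotangents compact_turn_cotangents assms
    by (auto simp: is_interval_connected)
  ultimately have "connected ?D" "compact ?D"
    unfolding D by (auto intro: connected_continuous_image compact_continuous_image)
  then obtain a b where ab: "?D = {a..b}"
    by (metis connected_compact_interval_1)
  with assms(5) have "a \<in> ?D" "a \<le> b" by auto
  then have "0 < a" by (auto simp: left_distances_def)
  with ab \<open>a \<le> b\<close> show thesis using that by blast
qed

text \<open>For \<open>x = y = 0\<close> the radius vanishes for every \<open>k\<close>,
  contradicting \<open>0 < ra\<close>. This serves to exclude arrivals at time 0.\<close>

lemma left_distances_start_empty: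
  assumes "0 < ra" "0 < pa" "pa \<le> pb" "pb < 2 * pi"
  shows "left_distances ra rb pa pb (0, 0) = {}"
  using assms by (subst left_distances_eq_image)
    (auto simp: turn_cotangents_def turn_radius_def)

section \<open>Reduction to left turns from the origin\<close>

definition mirrored_rotation :: "real \<Rightarrow> real \<Rightarrow> real \<times> real \<Rightarrow> real \<times> real" where
  "mirrored_rotation e a q = (cos a * fst q - sin a * (e * snd q), sin a * fst q + cos a * (e * snd q))"

text \<open>The signs cancel in \<open>(e * r) * (e * \<phi>)\<close>, so both sides switch from arc
  to line at the same distance; for \<open>e = -1\<close> the path is reflected in the initial
  heading.\<close>

lemma position_eq_left_path:
  assumes "e = 1 \<or> e = -1"
  shows "position v (e * r) (e * \<phi>) s t =
    (x0 v, y0 v) + mirrored_rotation e (theta0 v) (left_path r \<phi> (travelled s t))"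
  using assms
proof
  assume "e = 1"
  then show ?thesis
    by (simp add: position_def Let_def left_path_def mirrored_rotation_def sin_add cos_add algebra_simps)
next
  assume "e = -1"
  then show ?thesis
    by (simp add: position_def Let_def left_path_def mirrored_rotation_def sin_add cos_add
        sin_diff cos_diff algebra_simps)
qed

lemma bij_mirrored_rotation:
  assumes "e = 1 \<or> e = -1"
  shows "bij (\<lambda>q. (a, b) + mirrored_rotation e c q)"
proof -
  have e: "e * (e * z) = z" for z using assms by auto
  have "cos c * (cos c * z) + sin c * (sin c * z) = (cos c * cos c + sin c * sin c) * z" for z
    by (simp only: distrib_right mult.assoc)
  then have sc: "cos c * (cos c * z) + sin c * (sin c * z) = z" for z
    using sin_cos_squared_add3 by simp
  \<comment> \<open>The inverse: translate back, rotate by \<open>-c\<close>, then reflect, since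
    \<open>e\<close> is its own inverse.\<close>
  let ?g = "\<lambda>p. (cos c * (fst p - a) + sin c * (snd p - b),
                    e * (cos c * (snd p - b) - sin c * (fst p - a)))"
  show ?thesis
  proof (rule o_bij)
    show "?g \<circ> (\<lambda>q. (a, b) + mirrored_rotation e c q) = id"
    proof
      fix q :: "real \<times> real"
      obtain x y where q: "q = (x, y)" by (cases q)
      have "cos c * (cos c * x - sin c * z) + sin c * (sin c * x + cos c * z) = x"
        "cos c * (sin c * x + cos c * z) - sin c * (cos c * x - sin c * z) = z" for z
        using sc[of x] sc[of z] by (simp_all add: algebra_simps)
      then show "(?g \<circ> (\<lambda>q. (a, b) + mirrored_rotation e c q)) q = id q"
        by (simp add: q mirrored_rotation_def e)
    qed
    show "(\<lambda>q. (a, b) + mirrored_rotation e c q) \<circ> ?g = id"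
    proof
      fix p :: "real \<times> real"
      obtain x y where p: "p = (x, y)" by (cases p)
      have "cos c * (cos c * u + sin c * w) - sin c * (cos c * w - sin c * u) = u"
        "sin c * (cos c * u + sin c * w) + cos c * (cos c * w - sin c * u) = w" for u w
        using sc[of u] sc[of w] by (simp_all add: algebra_simps)
      then show "((\<lambda>q. (a, b) + mirrored_rotation e c q) \<circ> ?g) p = id p"
        by (simp add: p mirrored_rotation_def e)
    qed
  qed
qed

section \<open>From distances to arrival times\<close>

lemma travelled_const:
  assumes "0 \<le> t" shows "travelled (\<lambda>_. c) t = c * t"
  using assms by (simp add: travelled_def)

lemma travelled_bounds:
  assumes "continuous_on {0..} s" "\<forall>u\<ge>0. s u \<in> {a..b}" "0 \<le> t"
  shows "a * t \<le> travelled s t" "travelled s t \<le> b * t"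
proof -
  have s: "s integrable_on {0..t}"
    by (rule integrable_continuous_real) (rule continuous_on_subset[OF assms(1)], auto)
  have c: "((\<lambda>_. c) has_integral c * t) {0..t}" for c :: real
    using has_integral_const_real[of c 0 t] assms(3) by (simp add: mult.commute)
  show "a * t \<le> travelled s t" unfolding travelled_def
    by (rule has_integral_le[OF c integrable_integral[OF s]]) (use assms in auto)
  show "travelled s t \<le> b * t" unfolding travelled_def
    by (rule has_integral_le[OF integrable_integral[OF s] c]) (use assms in auto)
qed

lemma turn_to_bearing_motion_normalise:
  assumes "turn_to_bearing_motion v"
  obtains e ra rb pa pb where "e = 1 \<or> e = - 1" "0 < ra" "0 < pa" "pa \<le> pb" "pb < 2 * pi"
    "{r_alpha v..r_beta v} = (*) e ` {ra..rb}" "{theta_alpha v..theta_beta v} = (*) e ` {pa..pb}"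
proof -
  from assms consider
    "0 < r_alpha v" "0 < theta_alpha v" "theta_alpha v \<le> theta_beta v" "theta_beta v < 2 * pi"
  | "r_beta v < 0" "- 2 * pi < theta_alpha v" "theta_alpha v \<le> theta_beta v" "theta_beta v < 0"
    by (auto simp: turn_to_bearing_motion_def)
  then show thesis
  proof cases
    case 1
    then show ?thesis
      by (intro that[of 1 "r_alpha v" "theta_alpha v" "theta_beta v" "r_beta v"]) auto
  next
    case 2
    then show ?thesis
      \<comment> \<open>Negation reverses order, so the endpoints of both intervals swap.\<close>
      by (intro that[of "-1" "- r_beta v" "- theta_beta v" "- theta_alpha v" "- r_alpha v"])
        auto
  qed
qed

text \<open>A time \<open>t > 0\<close> is an arrival time iff the distances coverable by then,
  \<open>[s_alpha v * t, s_beta v * t]\<close>, meet the interval of distances to \<open>p\<close>.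
  The first set matches the collision condition, the second matches \<open>W\<close>; they agree
  because time 0 is impossible.\<close>

lemma arrival_times_interval:
  assumes v: "turn_to_bearing_motion v" and p: "p \<in> envelope v"
  obtains a b where "a \<le> b"
    "{t. 0 \<le> t \<and> (\<exists>J\<in>trajectories v. J t = p)} = {a..b}" "arrival_times v p = {a..b}"
proof -
  obtain e ra rb pa pb where e: "e = 1 \<or> e = - 1"
    and n: "0 < ra" "0 < pa" "pa \<le> pb" "pb < 2 * pi"
    and r: "{r_alpha v..r_beta v} = (*) e ` {ra..rb}"
    and th: "{theta_alpha v..theta_beta v} = (*) e ` {pa..pb}"
    using turn_to_bearing_motion_normalise[OF v] by metis
  have s: "0 < s_alpha v" "s_alpha v \<le> s_beta v"
    using v by (auto simp: turn_to_bearing_motion_def)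
  define F where "F q = (x0 v, y0 v) + mirrored_rotation e (theta0 v) q" for q
  have "bij F" unfolding F_def using e by (rule bij_mirrored_rotation)
  then obtain q where q: "p = F q" by (metis bij_pointE)
  have F: "F q1 = F q2 \<longleftrightarrow> q1 = q2" for q1 q2 using \<open>bij F\<close> by (meson bij_is_inj inj_eq)
  have pos: "position v (e * r') (e * \<phi>) s t = p \<longleftrightarrow> left_path r' \<phi> (travelled s t) = q"
    for r' \<phi> s t
    using position_eq_left_path[OF e] F by (simp add: q F_def)
  define speeds :: "(real \<Rightarrow> real) set" where
    "speeds = {s. continuous_on {0..} s \<and> (\<forall>u\<ge>0. s u \<in> {s_alpha v..s_beta v})}"
  define D where "D = left_distances ra rb pa pb q"
  have traj: "(\<exists>J\<in>trajectories v. J t = p) \<longleftrightarrow>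
      (\<exists>r\<in>{ra..rb}. \<exists>\<phi>\<in>{pa..pb}. \<exists>s\<in>speeds. left_path r \<phi> (travelled s t) = q)" for t
  proof -
    have "(\<exists>J\<in>trajectories v. J t = p) \<longleftrightarrow>
        (\<exists>r\<in>{r_alpha v..r_beta v}. \<exists>\<phi>\<in>{theta_alpha v..theta_beta v}. \<exists>s\<in>speeds. position v r \<phi> s t = p)"
      unfolding trajectories_def speeds_def by blast
    then show ?thesis unfolding r th by (simp add: pos)
  qed
  have trav_pos: "0 < travelled s t" if "s \<in> speeds" "0 < t" for s t
  proof -
    have "s_alpha v * t \<le> travelled s t"
      using that travelled_bounds(1)[of s _ _ t] by (auto simp: speeds_def)
    then show ?thesis using that s by (smt (verit) mult_pos_pos)
  qed
  have D_iff: "(\<exists>J\<in>trajectories v. J t = p) \<longleftrightarrow> (\<exists>s\<in>speeds. travelled s t \<in> D)" if "0 < t" for t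
    unfolding traj D_def left_distances_def using trav_pos that by auto
  obtain u where "0 < u" "\<exists>J\<in>trajectories v. J u = p" using p by (auto simp: envelope_def)
  then have "D \<noteq> {}" using D_iff by blast
  then obtain a b where ab: "0 < a" "a \<le> b" "D = {a..b}"
    unfolding D_def using left_distances_interval n by metis
  have "q \<noteq> (0, 0)" using left_distances_start_empty n \<open>D \<noteq> {}\<close> unfolding D_def by metis
  moreover have "left_path r \<phi> 0 = (0, 0)" if "r \<in> {ra..rb}" "\<phi> \<in> {pa..pb}" for r \<phi>
    using that n by (simp add: left_path_def)
  ultimately have not0: "\<not> (\<exists>J\<in>trajectories v. J 0 = p)"
    unfolding traj by (auto simp: travelled_def)
  have speed: "(\<exists>s\<in>speeds. travelled s t \<in> D) \<longleftrightarrow> t \<in> {a / s_beta v..b / s_alpha v}" if t: "0 < t" for t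
  proof
    assume "\<exists>s\<in>speeds. travelled s t \<in> D"
    then obtain f where f: "f \<in> speeds" "travelled f t \<in> D" by blast
    then have "s_alpha v * t \<le> travelled f t" "travelled f t \<le> s_beta v * t"
      using t travelled_bounds[of f "s_alpha v" "s_beta v" t] by (auto simp: speeds_def)
    then show "t \<in> {a / s_beta v..b / s_alpha v}"
      using f ab s by (auto simp: field_simps)
  next
    assume "t \<in> {a / s_beta v..b / s_alpha v}"
    then have le: "a \<le> s_beta v * t" "s_alpha v * t \<le> b"
      using s by (auto simp: field_simps)
    \<comment> \<open>The least point common to \<open>[a, b]\<close> and
      \<open>[s_alpha v * t, s_beta v * t]\<close>; the constant speed \<open>d / t\<close> covers
      it in time \<open>t\<close>.\<close>
    define d where "d = max a (s_alpha v * t)"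
    have "s_alpha v * t \<le> s_beta v * t" using s t by simp
    with le have "s_alpha v * t \<le> d" "d \<le> s_beta v * t" and "d \<in> D"
      using ab by (auto simp: d_def)
    then have "(\<lambda>_. d / t) \<in> speeds" "travelled (\<lambda>_. d / t) t \<in> D"
      using t by (auto simp: speeds_def travelled_const field_simps)
    then show "\<exists>s\<in>speeds. travelled s t \<in> D" by blast
  qed
  have "0 < a / s_beta v" using ab s by simp
  then have eq: "{t. 0 \<le> t \<and> (\<exists>J\<in>trajectories v. J t = p)} = {a / s_beta v..b / s_alpha v}"
    using not0 D_iff speed by (force simp: order_le_less)
  moreover have "arrival_times v p = {t. 0 \<le> t \<and> (\<exists>J\<in>trajectories v. J t = p)}"
    using not0 by (auto simp: arrival_times_def trajectories_through_def order_le_less)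
  moreover have "a / s_beta v \<le> b / s_alpha v" using ab s by (simp add: frac_le)
  ultimately show thesis using that by simp
qed

theorem theorem5:
  fixes ownship intruder :: turn_to_bearing and p :: "real \<times> real"
  assumes "turn_to_bearing_motion ownship" and "turn_to_bearing_motion intruder"
    and "p \<in> envelope ownship \<inter> envelope intruder"
  shows "W ownship intruder p \<longleftrightarrow>
    (\<exists>Jo\<in>trajectories ownship. \<exists>Ji\<in>trajectories intruder. \<exists>t\<ge>0. Jo t = p \<and> Ji t = p)"
proof -
  obtain a b where o: "a \<le> b" "{t. 0 \<le> t \<and> (\<exists>J\<in>trajectories ownship. J t = p)} = {a..b}"
    "arrival_times ownship p = {a..b}"
    using arrival_times_interval[OF assms(1), of p] assms(3) by blast
  obtain c d where i: "c \<le> d" "{t. 0 \<le> t \<and> (\<exists>J\<in>trajectories intruder. J t = p)} = {c..d}"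
    "arrival_times intruder p = {c..d}"
    using arrival_times_interval[OF assms(2), of p] assms(3) by blast
  have "W ownship intruder p \<longleftrightarrow> (a \<le> c \<and> c \<le> b) \<or> (c \<le> a \<and> a \<le> d)"
    using o(1,3) i(1,3) by (simp add: W_def earliest_def latest_def)
  \<comment> \<open>Nonempty closed intervals meet iff the larger left endpoint lies in the other
    interval.\<close>
  also have "\<dots> \<longleftrightarrow> {a..b} \<inter> {c..d} \<noteq> {}"
    using o(1) i(1) by auto
  also have "\<dots> \<longleftrightarrow>
      (\<exists>Jo\<in>trajectories ownship. \<exists>Ji\<in>trajectories intruder. \<exists>t\<ge>0. Jo t = p \<and> Ji t = p)"
    unfolding o(2)[symmetric] i(2)[symmetric] by blast
  finally show ?thesis .
qed

end
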